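(* Let $p$ be a prime and let $G$ be a finite $p$-group of exponent $p$. (1) If $|C_G(a)|\ge p^3$ for every element $a\in G$, then there is a $*$-covering $\mathcal{C}$ of $G$ such that $R_{\mathcal{C}}(G)\cong\mathbb{Z}_p$ (as rings). (2) Conversely, if $|G|\ge p^3$ and there is an element $a\in G$ with $|C_G(a)|=p^2$, then $R_{\mathcal{C}}(G)$ is not a simple ring for any $*$-covering $\mathcal{C}$ of $G$.
   Context: $\mathbb{Z}_p=\mathbb{Z}/p\mathbb{Z}$, and $C_G(a)$ denotes the centralizer of $a$ in $G$. A cover of a group $G$ is a collection $\mathcal{C}$ of subgroups of $G$ with $\bigcup_{C\in\mathcal{C}}C=G$. A $*$-covering of a finite $p$-group $G$ is a cover $\mathcal{C}$ each of whose members is either a maximal cyclic subgroup of $G$ (a cyclic subgroup not properly contained in another cyclic subgroup of $G$) or an elementary abelian subgroup of order $p^2$. For a cover $\mathcal{C}$ by abelian subgroups, $R_{\mathcal{C}}(G)=\{f:G\to G \mid f|_C\in \mathrm{End}(C)\text{ for each }C\in\mathcal{C}\}$, where $f|_C\in\mathrm{End}(C)$ means that $f$ maps $C$ into $C$ and is a homomorphism on $C$. It is a ring under pointwise addition (using the group operation of $G$) and composition of functions.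
   Formalization: In (2) the *-covering is assumed irredundant (no member properly contained in another), since for G nonabelian of order p^3 and exponent p the cover by all subgroups of order p or p^2 gives a ring isomorphic to Z_p; in (1) the covering found is also irredundant. *)

theory Defs
  imports "HOL-Algebra.Algebra"
begin

section \<open>Groups\<close>

definition centralizer :: "('a, 'b) monoid_scheme \<Rightarrow> 'a \<Rightarrow> 'a set" where
  "centralizer G a = {x \<in> carrier G. x \<otimes>\<^bsub>G\<^esub> a = a \<otimes>\<^bsub>G\<^esub> x}"

definition finite_p_group :: "nat \<Rightarrow> ('a, 'b) monoid_scheme \<Rightarrow> bool" where
  "finite_p_group p G \<longleftrightarrow> group G \<and> finite (carrier G) \<and> (\<exists>n. order G = p ^ n)"

text \<open>The least positive \<open>n\<close> with \<open>x\<^sup>n = 1\<close> for all \<open>x\<close>; it is only used for finite groups.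
  The trivial group has exponent 1, so a group of exponent \<open>p\<close> is nontrivial.\<close>

definition group_exponent :: "('a, 'b) monoid_scheme \<Rightarrow> nat" where
  "group_exponent G = (LEAST n. 0 < n \<and> (\<forall>x \<in> carrier G. x [^]\<^bsub>G\<^esub> n = \<one>\<^bsub>G\<^esub>))"

definition cyclic_subgroup :: "'a set \<Rightarrow> ('a, 'b) monoid_scheme \<Rightarrow> bool" where
  "cyclic_subgroup C G \<longleftrightarrow> subgroup C G \<and> cyclic_group (G\<lparr>carrier := C\<rparr>)"

definition maximal_cyclic_subgroup :: "'a set \<Rightarrow> ('a, 'b) monoid_scheme \<Rightarrow> bool" where
  "maximal_cyclic_subgroup C G \<longleftrightarrow>
     cyclic_subgroup C G \<and> \<not> (\<exists>D. cyclic_subgroup D G \<and> C \<subset> D)"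

definition elementary_abelian_subgroup ::
    "nat \<Rightarrow> 'a set \<Rightarrow> ('a, 'b) monoid_scheme \<Rightarrow> bool" where
  "elementary_abelian_subgroup p E G \<longleftrightarrow>
     subgroup E G \<and> comm_group (G\<lparr>carrier := E\<rparr>) \<and> (\<forall>x \<in> E. x [^]\<^bsub>G\<^esub> p = \<one>\<^bsub>G\<^esub>)"


section \<open>Covers\<close>

definition group_cover :: "('a, 'b) monoid_scheme \<Rightarrow> 'a set set \<Rightarrow> bool" where
  "group_cover G \<C> \<longleftrightarrow> (\<forall>C \<in> \<C>. subgroup C G) \<and> \<Union>\<C> = carrier G"

definition star_covering :: "nat \<Rightarrow> ('a, 'b) monoid_scheme \<Rightarrow> 'a set set \<Rightarrow> bool" where
  "star_covering p G \<C> \<longleftrightarrow> group_cover G \<C> \<and>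
     (\<forall>C \<in> \<C>. maximal_cyclic_subgroup C G \<or>
                (elementary_abelian_subgroup p C G \<and> card C = p\<^sup>2))"

text \<open>No member of the cover is properly contained in another. This is not part of
  \<open>star_covering\<close>, but for covers with redundant members the ring of the cover can be simple in
  spite of a small centralizer: if \<open>G\<close> is nonabelian of order \<open>p\<^sup>3\<close> and exponent \<open>p\<close>, then the
  collection of all subgroups of order \<open>p\<close> or \<open>p\<^sup>2\<close> satisfies \<open>star_covering\<close>, every noncentral
  element has a centralizer of order \<open>p\<^sup>2\<close>, and only the power maps \<open>x \<mapsto> x\<^sup>k\<close> respect this
  cover, so that its ring is isomorphic to the integers mod \<open>p\<close>.\<close>

definition irredundant :: "'a set set \<Rightarrow> bool" where
  "irredundant \<C> \<longleftrightarrow> \<not> (\<exists>C \<in> \<C>. \<exists>D \<in> \<C>. C \<subset> D)"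


section \<open>The ring of a cover\<close>

text \<open>Functions \<open>G \<rightarrow> G\<close> are represented by extensional functions on the carrier, so that
  equality in the ring is equality of functions on \<open>G\<close>. Membership of \<open>f\<close> in
  \<open>hom (G\<lparr>carrier := C\<rparr>) (G\<lparr>carrier := C\<rparr>)\<close> includes that \<open>f\<close> maps \<open>C\<close> into \<open>C\<close>.\<close>

definition cover_ring :: "('a, 'b) monoid_scheme \<Rightarrow> 'a set set \<Rightarrow> ('a \<Rightarrow> 'a) ring" where
  "cover_ring G \<C> =
    \<lparr>carrier = {f \<in> carrier G \<rightarrow>\<^sub>E carrier G.
        \<forall>C \<in> \<C>. f \<in> hom (G\<lparr>carrier := C\<rparr>) (G\<lparr>carrier := C\<rparr>)},
     monoid.mult = (\<lambda>f g. compose (carrier G) f g),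
     one = (\<lambda>x \<in> carrier G. x),
     ring.zero = (\<lambda>x \<in> carrier G. \<one>\<^bsub>G\<^esub>),
     add = (\<lambda>f g. \<lambda>x \<in> carrier G. f x \<otimes>\<^bsub>G\<^esub> g x)\<rparr>"

locale simple_ring = ring +
  assumes one_not_zero: "\<one> \<noteq> \<zero>"
    and trivial_ideals: "ideal I R \<Longrightarrow> I = {\<zero>} \<or> I = carrier R"


section \<open>Well-definedness\<close>

lemma star_covering_abelian:
  assumes "group G" "star_covering p G \<C>" "C \<in> \<C>"
  shows "comm_group (G\<lparr>carrier := C\<rparr>)"
proof -
  have "subgroup C G"
    using assms by (auto simp: star_covering_def group_cover_def)
  then have "group (G\<lparr>carrier := C\<rparr>)"
    using assms(1) by (simp add: subgroup.subgroup_is_group)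
  then show ?thesis
    using assms group.cyclic_imp_abelian_group[of "G\<lparr>carrier := C\<rparr>"]
    by (auto simp: star_covering_def maximal_cyclic_subgroup_def cyclic_subgroup_def
        elementary_abelian_subgroup_def)
qed

lemma ring_cover_ring:
  fixes G (structure)
  assumes "group G" and cov: "group_cover G \<C>"
    and ab: "\<And>C. C \<in> \<C> \<Longrightarrow> comm_group (G\<lparr>carrier := C\<rparr>)"
  shows "ring (cover_ring G \<C>)"
proof -
  interpret group G by fact
  let ?S = "cover_ring G \<C>"
  have sub: "subgroup C G" if "C \<in> \<C>" for C
    using cov that by (auto simp: group_cover_def)
  have ex: "\<exists>C \<in> \<C>. x \<in> C" if "x \<in> carrier G" for x
    using cov that by (auto simp: group_cover_def)
  have inC: "x \<in> carrier G" if "C \<in> \<C>" "x \<in> C" for x C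
    using sub[OF that(1)] that(2) by (rule subgroup.mem_carrier)
  have mC: "x \<otimes> y \<in> C" if "C \<in> \<C>" "x \<in> C" "y \<in> C" for x y C
    using sub[OF that(1)] that by (simp add: subgroup.m_closed)
  have comm: "x \<otimes> y = y \<otimes> x" if "C \<in> \<C>" "x \<in> C" "y \<in> C" for x y C
    using comm_monoid.m_comm[of "G\<lparr>carrier := C\<rparr>" x y] ab[OF that(1)] that
    by (simp add: comm_group_def)
  have carI: "(\<lambda>x \<in> carrier G. f x) \<in> carrier ?S"
    if f: "\<And>C x. C \<in> \<C> \<Longrightarrow> x \<in> C \<Longrightarrow> f x \<in> C"
      "\<And>C x y. C \<in> \<C> \<Longrightarrow> x \<in> C \<Longrightarrow> y \<in> C \<Longrightarrow> f (x \<otimes> y) = f x \<otimes> f y" for f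
  proof -
    have "f x \<in> carrier G" if "x \<in> carrier G" for x
      using ex[OF that] f(1) inC by blast
    moreover have "(\<lambda>x \<in> carrier G. f x) \<in> hom (G\<lparr>carrier := C\<rparr>) (G\<lparr>carrier := C\<rparr>)"
      if C: "C \<in> \<C>" for C
      by (rule homI) (simp_all add: inC[OF C] mC[OF C] f(1)[OF C] f(2)[OF C])
    ultimately show ?thesis
      by (simp add: cover_ring_def)
  qed
  have fext: "f \<in> extensional (carrier G)" if "f \<in> carrier ?S" for f
    using that by (simp add: cover_ring_def PiE_def)
  have val: "f x \<in> carrier G" if "f \<in> carrier ?S" "x \<in> carrier G" for f x
    using that by (auto simp add: cover_ring_def PiE_def)
  have fhom: "f \<in> hom (G\<lparr>carrier := C\<rparr>) (G\<lparr>carrier := C\<rparr>)"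
    if "f \<in> carrier ?S" "C \<in> \<C>" for f C
    using that by (simp add: cover_ring_def)
  have fC: "f x \<in> C" if "f \<in> carrier ?S" "C \<in> \<C>" "x \<in> C" for f x C
    using hom_in_carrier[OF fhom[OF that(1,2)], of x] that(3) by simp
  have fm: "f (x \<otimes> y) = f x \<otimes> f y" if "f \<in> carrier ?S" "C \<in> \<C>" "x \<in> C" "y \<in> C" for f x y C
    using hom_mult[OF fhom[OF that(1,2)], of x y] that(3,4) by simp
  have add: "f \<oplus>\<^bsub>?S\<^esub> g = (\<lambda>x \<in> carrier G. f x \<otimes> g x)" for f g
    by (simp add: cover_ring_def)
  have mult: "f \<otimes>\<^bsub>?S\<^esub> g = (\<lambda>x \<in> carrier G. f (g x))" for f g
    by (simp add: cover_ring_def compose_def)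
  have zero: "\<zero>\<^bsub>?S\<^esub> = (\<lambda>x \<in> carrier G. \<one>)" and one: "\<one>\<^bsub>?S\<^esub> = (\<lambda>x \<in> carrier G. x)"
    by (simp_all add: cover_ring_def)
  have four: "(a \<otimes> b) \<otimes> (c \<otimes> d) = (a \<otimes> c) \<otimes> (b \<otimes> d)"
    if "C \<in> \<C>" "a \<in> C" "b \<in> C" "c \<in> C" "d \<in> C" for a b c d C
  proof -
    have G: "a \<in> carrier G" "b \<in> carrier G" "c \<in> carrier G" "d \<in> carrier G"
      using that(2-5) by (simp_all add: inC[OF that(1)])
    have "(a \<otimes> b) \<otimes> (c \<otimes> d) = a \<otimes> ((b \<otimes> c) \<otimes> d)"
      using G by (simp add: m_assoc)
    also have "b \<otimes> c = c \<otimes> b"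
      by (rule comm[OF that(1,3,4)])
    also have "a \<otimes> ((c \<otimes> b) \<otimes> d) = (a \<otimes> c) \<otimes> (b \<otimes> d)"
      using G by (simp add: m_assoc)
    finally show ?thesis .
  qed
  have addc: "f \<oplus>\<^bsub>?S\<^esub> g \<in> carrier ?S" if f: "f \<in> carrier ?S" and g: "g \<in> carrier ?S" for f g
    unfolding add
  proof (rule carI)
    fix C x y assume C: "C \<in> \<C>" "x \<in> C" "y \<in> C"
    show "f (x \<otimes> y) \<otimes> g (x \<otimes> y) = (f x \<otimes> g x) \<otimes> (f y \<otimes> g y)"
      unfolding fm[OF f C] fm[OF g C]
      by (rule four[OF C(1) fC[OF f C(1,2)] fC[OF f C(1,3)] fC[OF g C(1,2)] fC[OF g C(1,3)]])
  qed (rule mC fC[OF f] fC[OF g] | assumption)+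
  have multc: "f \<otimes>\<^bsub>?S\<^esub> g \<in> carrier ?S" if f: "f \<in> carrier ?S" and g: "g \<in> carrier ?S" for f g
    unfolding mult
  proof (rule carI)
    fix C x y assume C: "C \<in> \<C>" "x \<in> C" "y \<in> C"
    show "f (g (x \<otimes> y)) = f (g x) \<otimes> f (g y)"
      unfolding fm[OF g C] by (rule fm[OF f C(1) fC[OF g C(1,2)] fC[OF g C(1,3)]])
  qed (rule fC[OF f] fC[OF g] | assumption)+
  have zeroc: "\<zero>\<^bsub>?S\<^esub> \<in> carrier ?S"
    unfolding zero using subgroup.one_closed[OF sub] by (intro carI) simp_all
  have onec: "\<one>\<^bsub>?S\<^esub> \<in> carrier ?S"
    unfolding one by (rule carI) simp_all
  have neg: "(\<lambda>x \<in> carrier G. inv f x) \<in> carrier ?S" if f: "f \<in> carrier ?S" for f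
  proof -
    have "inv f x \<in> C \<and> inv f (x \<otimes> y) = inv f x \<otimes> inv f y"
      if "C \<in> \<C>" "x \<in> C" "y \<in> C" for x y C
    proof -
      have fxy: "f x \<in> C" "f y \<in> C"
        using fC[OF f] that by auto
      then have "inv f x \<in> C"
        using subgroup.m_inv_closed[OF sub] that(1) by blast
      moreover have "inv f (x \<otimes> y) = inv (f y \<otimes> f x)"
        using fm[OF f that] comm[OF that(1) fxy] by simp
      ultimately show ?thesis
        using fxy inC[OF that(1)] by (simp add: inv_mult_group)
    qed
    then show ?thesis
      by (intro carI) blast+
  qed
  show ?thesis
  proof (rule ringI)
    show "abelian_group ?S"
    proof (rule abelian_groupI)
      fix f assume f: "f \<in> carrier ?S"
      show "\<exists>g \<in> carrier ?S. g \<oplus>\<^bsub>?S\<^esub> f = \<zero>\<^bsub>?S\<^esub>"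
        using neg[OF f] by (rule bexI[rotated]) (auto simp: add zero val[OF f] intro!: restrict_ext)
      show "\<zero>\<^bsub>?S\<^esub> \<oplus>\<^bsub>?S\<^esub> f = f"
        by (rule extensionalityI[of _ "carrier G"]) (auto simp: add zero val[OF f] fext[OF f])
    next
      fix f g assume fg: "f \<in> carrier ?S" "g \<in> carrier ?S"
      show "f \<oplus>\<^bsub>?S\<^esub> g = g \<oplus>\<^bsub>?S\<^esub> f"
        unfolding add
      proof (rule restrict_ext)
        fix x assume "x \<in> carrier G"
        then obtain C where C: "C \<in> \<C>" "x \<in> C"
          using ex by blast
        show "f x \<otimes> g x = g x \<otimes> f x"
          by (rule comm[OF C(1) fC[OF fg(1) C] fC[OF fg(2) C]])
      qed
    qed (auto simp: addc zeroc, auto simp: add val m_assoc intro!: restrict_ext)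
    show "Group.monoid ?S"
    proof (rule monoidI)
      fix f assume f: "f \<in> carrier ?S"
      show "\<one>\<^bsub>?S\<^esub> \<otimes>\<^bsub>?S\<^esub> f = f" "f \<otimes>\<^bsub>?S\<^esub> \<one>\<^bsub>?S\<^esub> = f"
        by (rule extensionalityI[of _ "carrier G"]; auto simp: mult one val[OF f] fext[OF f])+
    qed (auto simp: multc onec, auto simp: mult val intro!: restrict_ext)
  next
    fix f g h assume fgh: "f \<in> carrier ?S" "g \<in> carrier ?S" "h \<in> carrier ?S"
    show "(f \<oplus>\<^bsub>?S\<^esub> g) \<otimes>\<^bsub>?S\<^esub> h = f \<otimes>\<^bsub>?S\<^esub> h \<oplus>\<^bsub>?S\<^esub> g \<otimes>\<^bsub>?S\<^esub> h"
      by (auto simp: add mult val[OF fgh(3)] intro!: restrict_ext)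
    have "h (f x \<otimes> g x) = h (f x) \<otimes> h (g x)" if x: "x \<in> carrier G" for x
    proof -
      obtain C where C: "C \<in> \<C>" "x \<in> C"
        using ex[OF x] by blast
      show ?thesis
        by (rule fm[OF fgh(3) C(1) fC[OF fgh(1) C] fC[OF fgh(2) C]])
    qed
    then show "h \<otimes>\<^bsub>?S\<^esub> (f \<oplus>\<^bsub>?S\<^esub> g) = h \<otimes>\<^bsub>?S\<^esub> f \<oplus>\<^bsub>?S\<^esub> h \<otimes>\<^bsub>?S\<^esub> g"
      unfolding add mult using val[OF fgh(1)] val[OF fgh(2)] by (intro restrict_ext) simp
  qed
qed

corollary ring_cover_ring_star_covering:
  assumes "group G" "star_covering p G \<C>"
  shows "ring (cover_ring G \<C>)"
  using assms ring_cover_ring star_covering_abelian by (metis star_covering_def)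

end

theory Submission
  imports Defs
begin

text \<open>
  (1) Cover \<open>G\<close> by all subgroups of order \<open>p\<^sup>2\<close>. A large centralizer of \<open>a \<noteq> 1\<close> yields two members
  meeting in \<open>\<langle>a\<rangle>\<close>, so an element \<open>f\<close> of the ring sends every \<open>a\<close> to a power of itself. Comparing
  the exponents of \<open>f\<close> at \<open>x\<close>, at a fixed central \<open>z \<noteq> 1\<close> and at \<open>z x\<close> shows that \<open>f\<close> is a
  power map \<open>x \<mapsto> x\<^sup>k\<close>.

  (2) The functions in the ring that are trivial on a set \<open>S\<close> form an ideal if the ring maps \<open>S\<close>
  into itself. Let \<open>A = C\<^sub>G(a)\<close>, which properly contains the center \<open>Z\<close>; every \<open>x \<in> A - Z\<close> has
  centralizer \<open>A\<close>. If the member containing \<open>a\<close> meets all other members trivially, let \<open>S\<close> be that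
  member. Otherwise \<open>A\<close> is a member, all others meet it inside \<open>Z\<close>, and \<open>S = (G - A) \<union> Z\<close> works:
  the map \<open>a\<^sup>i z\<^sup>j \<mapsto> z\<^sup>i\<close> on \<open>A\<close>, trivial elsewhere, lies in the ideal.
\<close>

section \<open>Centers and subgroup chains\<close>

definition group_center :: "('a, 'b) monoid_scheme \<Rightarrow> 'a set" where
  "group_center G = {z \<in> carrier G. \<forall>x \<in> carrier G. z \<otimes>\<^bsub>G\<^esub> x = x \<otimes>\<^bsub>G\<^esub> z}"

context group
begin

lemma commute_inv:
  assumes "x \<in> carrier G" "y \<in> carrier G" "x \<otimes> y = y \<otimes> x"
  shows "inv x \<otimes> y = y \<otimes> inv x"
  using assms by (metis inv_closed inv_solve_left inv_solve_right m_assoc m_closed)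

lemma subgroup_centralizer:
  assumes a: "a \<in> carrier G"
  shows "subgroup (centralizer G a) G"
proof (rule subgroupI)
  show "centralizer G a \<noteq> {}"
    using a by (auto simp: centralizer_def)
next
  fix x y assume xy: "x \<in> centralizer G a" "y \<in> centralizer G a"
  then have c: "x \<in> carrier G" "y \<in> carrier G" "x \<otimes> a = a \<otimes> x" "y \<otimes> a = a \<otimes> y"
    by (auto simp: centralizer_def)
  then have "x \<otimes> y \<otimes> a = a \<otimes> (x \<otimes> y)"
    using a by (metis m_assoc)
  then show "x \<otimes> y \<in> centralizer G a"
    using c by (simp add: centralizer_def)
qed (auto simp: centralizer_def a commute_inv)

lemma group_center_eq_Inter: "group_center G = (\<Inter>a \<in> carrier G. centralizer G a)"
  by (auto simp: group_center_def centralizer_def)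

lemma subgroup_group_center: "subgroup (group_center G) G"
  unfolding group_center_eq_Inter
  by (rule subgroups_Inter) (auto intro: subgroup_centralizer)

lemma card_subgroup_dvd:
  assumes "subgroup H G" "subgroup K G" "H \<subseteq> K"
  shows "card H dvd card K"
proof -
  interpret K: group "G\<lparr>carrier := K\<rparr>"
    using assms(2) by (rule subgroup_imp_group)
  have "subgroup H (G\<lparr>carrier := K\<rparr>)"
    using assms by (rule subgroup_incl)
  from K.lagrange[OF this] show ?thesis
    by (auto simp: order_def dest: sym)
qed

text \<open>By Lagrange all three orders are powers of \<open>p\<close>, and each proper inclusion
  lowers the exponent; two strict steps down from exponent 2 leave exponent 0.\<close>

lemma subgroup_chain_prime_square:
  assumes p: "Factorial_Ring.prime p" and fin: "finite (carrier G)"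
    and sub: "subgroup H G" "subgroup K G" "subgroup A G"
    and card: "card A = p\<^sup>2" and chain: "H \<subset> K" "K \<subset> A"
  shows "H = {\<one>}"
proof -
  have finA: "finite A"
    using sub(3) fin by (meson finite_subset subgroup.subset)
  then have "card K < card A" "card H < card K"
    using chain by (auto intro!: psubset_card_mono finite_subset[OF _ finA])
  moreover obtain k where "k \<le> 2" "card K = p ^ k"
    using card_subgroup_dvd[OF sub(2,3)] chain p card by (auto simp: divides_primepow_nat)
  moreover obtain h where "h \<le> 2" "card H = p ^ h"
    using card_subgroup_dvd[OF sub(1,3)] chain p card by (auto simp: divides_primepow_nat)
  ultimately have "k < 2" "h < k"
    using card prime_gt_1_nat[OF p] by auto
  then have "card H = 1"
    using \<open>card H = p ^ h\<close> by simp
  then show ?thesis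
    using subgroup.one_closed[OF sub(1)] by (auto simp: card_Suc_eq)
qed

text \<open>Class equation: conjugacy classes have \<open>p\<close>-power size, and a class of size
  1 consists of a central element. With a trivial center, \<open>{\<one>}\<close> would be the only
  such class, so \<open>p ^ n\<close> would be 1 modulo \<open>p\<close>.\<close>

lemma p_group_center_nontrivial:
  assumes p: "Factorial_Ring.prime p" and fin: "finite (carrier G)"
    and ord: "order G = p ^ n" and "carrier G \<noteq> {\<one>}"
  shows "group_center G \<noteq> {\<one>}"
proof
  assume triv: "group_center G = {\<one>}"
  define conj where "conj = (\<lambda>g. \<lambda>h \<in> carrier G. g \<otimes> h \<otimes> inv g)"
  interpret act: group_action G "carrier G" conj
    unfolding conj_def by (rule action_by_conjugation)
  let ?O = "orbits G (carrier G) conj"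
  have finO: "finite ?O"
    using finite_UnionD[of ?O] act.orbits_coverture fin by simp
  have dvd: "card b dvd p ^ n" if "b \<in> ?O" for b
    using that act.orbit_stabilizer_theorem unfolding ord
    by (auto simp: orbits_def intro: dvdI[OF sym])
  have single: "b = {\<one>}" if b: "b \<in> ?O" and "card b = 1" for b
  proof -
    obtain x where x: "x \<in> carrier G" "b = orbit G conj x"
      using b by (auto simp: orbits_def)
    have "x \<in> b"
      using act.orbit_refl[OF x(1)] x(2) by simp
    then have bx: "b = {x}"
      using \<open>card b = 1\<close> by (auto simp: card_Suc_eq)
    have "x \<otimes> g = g \<otimes> x" if g: "g \<in> carrier G" for g
    proof -
      have "conj g x \<in> b"
        using g x by (auto simp: orbit_def)
      then have "g \<otimes> x \<otimes> inv g = x"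
        using bx x by (simp add: conj_def)
      then show ?thesis
        using g x(1) by (metis inv_solve_right m_closed)
    qed
    then show ?thesis
      using x(1) triv bx by (auto simp: group_center_def)
  qed
  have one: "{\<one>} \<in> ?O"
  proof -
    have "orbit G conj \<one> = {\<one>}"
      by (auto simp: orbit_def conj_def intro: exI[of _ \<one>])
    then show ?thesis
      by (auto simp: orbits_def)
  qed
  have "p dvd card b" if b: "b \<in> ?O - {{\<one>}}" for b
  proof -
    obtain k where k: "card b = p ^ k"
      using dvd[of b] b p by (auto simp: divides_primepow_nat)
    moreover have "k \<noteq> 0"
      using single[of b] b k by auto
    ultimately show ?thesis
      by simp
  qed
  then have "p dvd (\<Sum>b \<in> ?O - {{\<one>}}. card b)"
    by (rule dvd_sum)
  moreover have "p ^ n = 1 + (\<Sum>b \<in> ?O - {{\<one>}}. card b)"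
  proof -
    have "(\<Sum>b \<in> ?O. card b) = p ^ n"
      using act.disjoint_sum[OF fin, of "\<lambda>_. 1::nat"] ord by (simp add: order_def)
    then show ?thesis
      using sum.remove[OF finO one, of card] by simp
  qed
  moreover have "n \<noteq> 0"
  proof
    assume "n = 0"
    then have "card (carrier G) = 1"
      using ord by (simp add: order_def)
    then obtain b where "carrier G = {b}"
      by (auto simp: card_Suc_eq)
    then show False
      using \<open>carrier G \<noteq> {\<one>}\<close> one_closed by auto
  qed
  then have "p dvd p ^ n"
    by simp
  ultimately have "p dvd 1"
    by (metis dvd_add_left_iff)
  then show False
    using p by (simp add: not_prime_unit)
qed

section \<open>Subgroups generated by one element or by two commuting elements\<close>

lemma subgroup_range_int_pow:
  assumes "a \<in> carrier G"
  shows "subgroup (range (\<lambda>k::int. a [^] k)) G"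
  using generate_is_subgroup[of "{a}"] generate_pow[OF assms] assms
  by (simp add: full_SetCompr_eq)

text \<open>For commuting \<open>a\<close> and \<open>b\<close> this is the subgroup they generate.
  The explicit form provides exponents as coordinates; integer exponents cover inverses.\<close>

definition power_span :: "'a \<Rightarrow> 'a \<Rightarrow> 'a set" where
  "power_span a b = {a [^] i \<otimes> b [^] j | (i::int) (j::int). True}"

text \<open>The centralizer of \<open>y\<close> is a subgroup, so with \<open>x\<close> it contains
  all powers of \<open>x\<close>.\<close>

lemma commute_int_pow:
  assumes "x \<in> carrier G" "y \<in> carrier G" "x \<otimes> y = y \<otimes> x"
  shows "x [^] (i::int) \<otimes> y = y \<otimes> x [^] i"
proof -
  have "x [^] i \<in> centralizer G y"
    using assms by (intro subgroup_int_pow_closed subgroup_centralizer)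
      (simp_all add: centralizer_def)
  then show ?thesis
    by (simp add: centralizer_def)
qed

lemma power_span_mult:
  fixes i j k l :: int
  assumes "a \<in> carrier G" "b \<in> carrier G" "a \<otimes> b = b \<otimes> a"
  shows "(a [^] i \<otimes> b [^] j) \<otimes> (a [^] k \<otimes> b [^] l) = a [^] (i + k) \<otimes> b [^] (j + l)"
    (is "?lhs = _")
proof -
  have comm: "b [^] j \<otimes> a [^] k = a [^] k \<otimes> b [^] j"
    using assms commute_int_pow[of b "a [^] k" j] commute_int_pow[of a b k] by simp
  have "?lhs = a [^] i \<otimes> (b [^] j \<otimes> a [^] k) \<otimes> b [^] l"
    using assms by (simp add: m_assoc)
  also have "\<dots> = a [^] i \<otimes> a [^] k \<otimes> (b [^] j \<otimes> b [^] l)"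
    using assms unfolding comm by (simp add: m_assoc)
  finally show ?thesis
    using assms by (simp add: int_pow_mult)
qed

lemma subgroup_power_span:
  assumes "a \<in> carrier G" "b \<in> carrier G" "a \<otimes> b = b \<otimes> a"
  shows "subgroup (power_span a b) G"
proof (rule subgroupI)
  fix x y assume xy: "x \<in> power_span a b" "y \<in> power_span a b"
  then show "x \<otimes> y \<in> power_span a b"
    using power_span_mult[OF assms] by (fastforce simp: power_span_def)
next
  fix x assume "x \<in> power_span a b"
  then obtain i j :: int where x: "x = a [^] i \<otimes> b [^] j"
    by (auto simp: power_span_def)
  have "(a [^] (-i) \<otimes> b [^] (-j)) \<otimes> x = \<one>"
    unfolding x power_span_mult[OF assms] using assms by simp
  then have "inv x = a [^] (-i) \<otimes> b [^] (-j)"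
    using assms x by (intro inv_equality) auto
  then show "inv x \<in> power_span a b"
    by (auto simp: power_span_def)
qed (use assms in \<open>auto simp: power_span_def\<close>)

lemma power_span_incl:
  assumes "a \<in> carrier G" "b \<in> carrier G"
  shows "a \<in> power_span a b" "b \<in> power_span a b"
proof -
  have "a = a [^] (1::int) \<otimes> b [^] (0::int)" "b = a [^] (0::int) \<otimes> b [^] (1::int)"
    using assms by simp_all
  then show "a \<in> power_span a b" "b \<in> power_span a b"
    unfolding power_span_def by blast+
qed

lemma power_span_commute:
  assumes "a \<in> carrier G" "b \<in> carrier G" "a \<otimes> b = b \<otimes> a"
    and "x \<in> power_span a b" "y \<in> power_span a b"
  shows "x \<otimes> y = y \<otimes> x"
  using assms(4,5) unfolding power_span_def
  by (auto simp: power_span_mult[OF assms(1-3)] add.commute)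

lemma hom_int_pow_subgroup:
  assumes C: "subgroup C G" and f: "f \<in> hom (G\<lparr>carrier := C\<rparr>) (G\<lparr>carrier := C\<rparr>)" and x: "x \<in> C"
  shows "f (x [^] (k::int)) = f x [^] k"
proof -
  interpret C: group_hom "G\<lparr>carrier := C\<rparr>" "G\<lparr>carrier := C\<rparr>" f
    using C f by (simp add: group_hom_def group_hom_axioms_def subgroup_imp_group)
  show ?thesis
    using C.hom_int_pow[of x k] x C.hom_closed[of x] int_pow_consistent[OF C, symmetric] by simp
qed

end


section \<open>Groups of prime exponent\<close>

text \<open>\<open>pow_p\<close> also holds in the trivial group, so statements about exact orders
  carry their own assumption \<open>x \<noteq> \<one>\<close>.\<close>

locale prime_exponent_group = group G for G (structure) +
  fixes p :: nat
  assumes prime_p: "Factorial_Ring.prime p"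
    and finite_carrier: "finite (carrier G)"
    and pow_p: "x \<in> carrier G \<Longrightarrow> x [^] p = \<one>"
begin

lemma int_pow_eq_one_iff:
  assumes "x \<in> carrier G" "x \<noteq> \<one>"
  shows "x [^] (k::int) = \<one> \<longleftrightarrow> int p dvd k"
proof -
  have "ord x dvd p" "ord x \<noteq> 1"
    using assms pow_p pow_eq_id[of x p] ord_eq_1[of x] by simp_all
  then have "ord x = p"
    using prime_p by (auto simp: prime_nat_iff)
  then show ?thesis
    using int_pow_eq_id[OF assms(1)] by simp
qed

lemma int_pow_eq_iff:
  assumes "x \<in> carrier G" "x \<noteq> \<one>"
  shows "x [^] (k::int) = x [^] l \<longleftrightarrow> int p dvd k - l"
proof -
  have "x [^] (k - l) = x [^] k \<otimes> inv (x [^] l)"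
    using assms by (simp add: int_pow_diff)
  then have "x [^] k = x [^] l \<longleftrightarrow> x [^] (k - l) = \<one>"
    using assms by (metis int_pow_closed inv_closed inv_equality inv_inv r_inv)
  then show ?thesis
    using int_pow_eq_one_iff[OF assms] by simp
qed

lemma int_pow_cong:
  assumes "x \<in> carrier G" "int p dvd k - l"
  shows "x [^] (k::int) = x [^] l"
  using assms int_pow_eq_iff by (cases "x = \<one>") auto

text \<open>An exponent prime to \<open>p\<close> is invertible modulo \<open>p\<close> by Bezout,
  so \<open>x\<close> is itself a power of \<open>x [^] k\<close>.\<close>

lemma mem_of_int_pow_mem:
  assumes H: "subgroup H G" and x: "x \<in> carrier G"
    and mem: "x [^] (k::int) \<in> H" and k: "\<not> int p dvd k"
  shows "x \<in> H"
proof -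
  have "coprime k (int p)"
    using k prime_p prime_imp_coprime[of "int p" k] by (simp add: coprime_commute)
  then obtain u v where "u * k + v * int p = 1"
    by (metis bezout_int coprime_iff_gcd_eq_1)
  then have "int p dvd k * u - 1"
    by (metis add_diff_cancel_left' diff_diff_eq2 dvd_minus_iff dvd_triv_right minus_diff_eq
        mult.commute)
  then have "x = (x [^] k) [^] u"
    using int_pow_cong[OF x, of "k * u" 1] x by (simp add: int_pow_pow)
  then show ?thesis
    using subgroup_int_pow_closed[OF H mem] by metis
qed

text \<open>Coordinates are unique modulo \<open>p\<close>: the equation equates a power of
  \<open>a\<close> with a power of \<open>b\<close>, and if the exponent of \<open>b\<close> were
  prime to \<open>p\<close>, then \<open>b\<close> itself would be a power of
  \<open>a\<close>.\<close>

lemma power_span_eq_dest: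
  assumes ab: "a \<in> carrier G" "b \<in> carrier G" "a \<otimes> b = b \<otimes> a"
    and a: "a \<noteq> \<one>" and b: "b \<notin> range (\<lambda>k::int. a [^] k)"
    and eq: "a [^] i \<otimes> b [^] j = a [^] k \<otimes> b [^] (l::int)"
  shows "int p dvd i - k" "int p dvd j - l"
proof -
  have "a [^] (-k) \<otimes> b [^] (-j) \<otimes> (a [^] i \<otimes> b [^] j)
      = a [^] (-k) \<otimes> b [^] (-j) \<otimes> (a [^] k \<otimes> b [^] l)"
    using eq by simp
  then have eq': "a [^] (i - k) = b [^] (l - j)"
    unfolding power_span_mult[OF ab] using ab by (simp add: add.commute)
  then have "b [^] (l - j) \<in> range (\<lambda>k::int. a [^] k)"
    by (metis rangeI)
  then have "int p dvd l - j"
    using mem_of_int_pow_mem[OF subgroup_range_int_pow[OF ab(1)] ab(2)] b by blast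
  moreover from this have "a [^] (i - k) = \<one>"
    using int_pow_cong[OF ab(2), of "l - j" 0] eq' by simp
  ultimately show "int p dvd i - k" "int p dvd j - l"
    using int_pow_eq_one_iff[OF ab(1) a] by (auto simp: dvd_diff_commute)
qed

text \<open>Exponents matter only modulo \<open>p\<close> and are unique modulo \<open>p\<close>, so
  pairs of residues index the elements.\<close>

lemma card_power_span:
  assumes ab: "a \<in> carrier G" "b \<in> carrier G" "a \<otimes> b = b \<otimes> a"
    and a: "a \<noteq> \<one>" and b: "b \<notin> range (\<lambda>k::int. a [^] k)"
  shows "card (power_span a b) = p\<^sup>2"
proof -
  let ?I = "{0..<int p}"
  have eqI: "i = k" if "int p dvd i - k" "i \<in> ?I" "k \<in> ?I" for i k
    using that zdvd_imp_le[of "int p" "i - k"] zdvd_imp_le[of "int p" "k - i"]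
    by (cases i k rule: linorder_cases) (auto simp: dvd_diff_commute)
  have "bij_betw (\<lambda>(i, j). a [^] i \<otimes> b [^] j) (?I \<times> ?I) (power_span a b)"
    unfolding bij_betw_def
  proof
    show "inj_on (\<lambda>(i, j). a [^] i \<otimes> b [^] j) (?I \<times> ?I)"
      by (rule inj_onI) (auto dest: power_span_eq_dest[OF ab a b] intro!: eqI)
    have "a [^] i \<otimes> b [^] j = a [^] (i mod int p) \<otimes> b [^] (j mod int p)" for i j :: int
      using int_pow_cong[OF ab(1), of i "i mod int p"] int_pow_cong[OF ab(2), of j "j mod int p"]
      by simp
    moreover have "i mod int p \<in> ?I" for i
      using prime_gt_0_nat[OF prime_p] by simp
    ultimately have "a [^] i \<otimes> b [^] j \<in> (\<lambda>(i, j). a [^] i \<otimes> b [^] j) ` (?I \<times> ?I)"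
      for i j :: int
      by (intro image_eqI[of _ _ "(i mod int p, j mod int p)"]) auto
    then show "(\<lambda>(i, j). a [^] i \<otimes> b [^] j) ` (?I \<times> ?I) = power_span a b"
      by (auto simp: power_span_def)
  qed
  then show ?thesis
    by (simp add: bij_betw_same_card[symmetric] card_cartesian_product power2_eq_square)
qed

lemma elementary_abelian_power_span:
  assumes ab: "a \<in> carrier G" "b \<in> carrier G" "a \<otimes> b = b \<otimes> a"
  shows "elementary_abelian_subgroup p (power_span a b) G"
proof -
  have S: "subgroup (power_span a b) G"
    using ab by (rule subgroup_power_span)
  moreover have "comm_group (G\<lparr>carrier := power_span a b\<rparr>)"
    using power_span_commute[OF ab] subgroup_imp_group[OF S]
    by (intro group.group_comm_groupI) auto
  ultimately show ?thesis
    using pow_p subgroup.mem_carrier[OF S] by (simp add: elementary_abelian_subgroup_def)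
qed

end

section \<open>Ideals of functions vanishing on a set\<close>

context group
begin

lemma group_coverE:
  assumes "group_cover G \<C>" "x \<in> carrier G"
  obtains C where "C \<in> \<C>" "subgroup C G" "x \<in> C"
proof -
  have "x \<in> \<Union>\<C>"
    using assms by (simp add: group_cover_def)
  then show ?thesis
    using assms(1) that by (auto simp: group_cover_def)
qed

text \<open>Elementwise form of membership. That \<open>f\<close> maps \<open>carrier G\<close> into
  itself follows from its mapping each member into itself, because the members are subgroups that
  exhaust the group.\<close>

lemma mem_cover_ring_iff:
  assumes cov: "group_cover G \<C>"
  shows "f \<in> carrier (cover_ring G \<C>) \<longleftrightarrow> f \<in> extensional (carrier G) \<and>
    (\<forall>C \<in> \<C>. \<forall>x \<in> C. f x \<in> C \<and> (\<forall>y \<in> C. f (x \<otimes> y) = f x \<otimes> f y))"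
    (is "_ \<longleftrightarrow> ?R")
proof
  assume "f \<in> carrier (cover_ring G \<C>)"
  then show ?R
    by (auto simp: cover_ring_def hom_def PiE_def Pi_iff)
next
  assume R: ?R
  have "f x \<in> carrier G" if x: "x \<in> carrier G" for x
  proof -
    obtain C where C: "C \<in> \<C>" "subgroup C G" "x \<in> C"
      using group_coverE[OF cov x] .
    have "f x \<in> C"
      using R C by blast
    with C(2) show ?thesis
      by (rule subgroup.mem_carrier)
  qed
  then show "f \<in> carrier (cover_ring G \<C>)"
    using R by (auto simp: cover_ring_def hom_def PiE_def)
qed

text \<open>If \<open>f\<close> is trivial on \<open>S\<close>, then \<open>f\<close> after
  \<open>g\<close> is trivial on \<open>S\<close> because \<open>g\<close> maps \<open>S\<close>
  into itself, and \<open>g\<close> after \<open>f\<close> because \<open>g\<close> fixes the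
  neutral element.\<close>

lemma ideal_vanishing:
  assumes R: "ring (cover_ring G \<C>)" and cov: "group_cover G \<C>" and S: "S \<subseteq> carrier G"
    and inv: "\<And>g x. g \<in> carrier (cover_ring G \<C>) \<Longrightarrow> x \<in> S \<Longrightarrow> g x \<in> S"
  shows "ideal {f \<in> carrier (cover_ring G \<C>). \<forall>x \<in> S. f x = \<one>} (cover_ring G \<C>)"
    (is "ideal ?I ?R")
proof -
  interpret R: ring ?R by fact
  have val: "f x \<in> carrier G" if "f \<in> carrier ?R" "x \<in> carrier G" for f x
    using that by (auto simp: cover_ring_def)
  have add: "(f \<oplus>\<^bsub>?R\<^esub> g) x = f x \<otimes> g x" if "x \<in> S" for f g x
    using that S by (auto simp: cover_ring_def)
  have zero: "\<zero>\<^bsub>?R\<^esub> x = \<one>" if "x \<in> S" for x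
    using that S by (auto simp: cover_ring_def)
  have mult: "(f \<otimes>\<^bsub>?R\<^esub> g) x = f (g x)" if "x \<in> S" for f g x
    using that S by (auto simp: cover_ring_def compose_def)
  have f1: "f \<one> = \<one>" if f: "f \<in> carrier ?R" for f
  proof -
    obtain C where "C \<in> \<C>" "subgroup C G" "\<one> \<in> C"
      using group_coverE[OF cov one_closed] .
    then have "f (\<one> \<otimes> \<one>) = f \<one> \<otimes> f \<one>"
      using f unfolding mem_cover_ring_iff[OF cov] by blast
    then show ?thesis
      using val[OF f one_closed] by simp
  qed
  show ?thesis
  proof (rule idealI)
    show "subgroup ?I (add_monoid ?R)"
    proof
      fix f g assume "f \<in> ?I" "g \<in> ?I"
      then show "f \<otimes>\<^bsub>add_monoid ?R\<^esub> g \<in> ?I"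
        by (auto simp: add)
    next
      fix f assume f: "f \<in> ?I"
      have "(\<ominus>\<^bsub>?R\<^esub> f) x = \<one>" if x: "x \<in> S" for x
      proof -
        have "(\<ominus>\<^bsub>?R\<^esub> f \<oplus>\<^bsub>?R\<^esub> f) x = \<one>"
          using f x by (simp add: R.l_neg zero)
        moreover have "f x = \<one>"
          using f x by simp
        ultimately show ?thesis
          using val[of "\<ominus>\<^bsub>?R\<^esub> f" x] f x S by (auto simp: add)
      qed
      then show "inv\<^bsub>add_monoid ?R\<^esub> f \<in> ?I"
        unfolding a_inv_def[symmetric] using f by simp
    qed (auto simp: zero)
  next
    fix f g assume "f \<in> ?I" "g \<in> carrier ?R"
    then show "g \<otimes>\<^bsub>?R\<^esub> f \<in> ?I" "f \<otimes>\<^bsub>?R\<^esub> g \<in> ?I"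
      using inv by (auto simp: mult f1)
  qed (rule R)
qed

text \<open>The function \<open>f\<close> shows that the ideal of functions trivial on
  \<open>S\<close> is nonzero; the element \<open>s\<close> shows that it omits the identity
  function.\<close>

lemma not_simple_cover_ring:
  assumes R: "ring (cover_ring G \<C>)" and cov: "group_cover G \<C>" and S: "S \<subseteq> carrier G"
    and inv: "\<And>g x. g \<in> carrier (cover_ring G \<C>) \<Longrightarrow> x \<in> S \<Longrightarrow> g x \<in> S"
    and nt: "s \<in> S" "s \<noteq> \<one>"
    and f: "f \<in> carrier (cover_ring G \<C>)" "\<And>x. x \<in> S \<Longrightarrow> f x = \<one>"
      "y \<in> carrier G" "f y \<noteq> \<one>"
  shows "\<not> simple_ring (cover_ring G \<C>)"
proof
  let ?R = "cover_ring G \<C>"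
  let ?I = "{f \<in> carrier ?R. \<forall>x \<in> S. f x = \<one>}"
  assume "simple_ring ?R"
  then interpret R: simple_ring ?R .
  have "?I = {\<zero>\<^bsub>?R\<^esub>} \<or> ?I = carrier ?R"
    using assms(1-4) by (intro R.trivial_ideals ideal_vanishing)
  moreover have "f \<in> ?I" "f \<noteq> \<zero>\<^bsub>?R\<^esub>"
    using f by (auto simp: cover_ring_def)
  moreover have "\<one>\<^bsub>?R\<^esub> s \<noteq> \<one>"
    using nt S by (auto simp: cover_ring_def)
  then have "\<one>\<^bsub>?R\<^esub> \<notin> ?I"
    using nt(1) by blast
  ultimately show False
    using R.one_closed by blast
qed

end


section \<open>Covers of groups of prime exponent\<close>

context prime_exponent_group
begin

section \<open>The ring of a cover when all centralizers are large\<close>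

text \<open>The first isomorphism theorem is applied to the map \<open>h\<close> from integers to
  power maps. Its kernel is generated by \<open>p\<close>; its surjectivity rests on
  \<open>pair\<close> and on the central element \<open>z\<close>.\<close>

lemma cover_ring_iso_ZFact:
  assumes cent: "\<And>a. a \<in> carrier G \<Longrightarrow> card (centralizer G a) \<ge> p ^ 3"
    and z: "z \<in> group_center G" "z \<noteq> \<one>"
  defines "\<C> \<equiv> {P. elementary_abelian_subgroup p P G \<and> card P = p\<^sup>2}"
  shows "star_covering p G \<C> \<and> irredundant \<C> \<and> cover_ring G \<C> \<simeq> ZFact (int p)"
proof -
  have p1: "p > 1"
    using prime_p by (rule prime_gt_1_nat)
  have subC: "subgroup P G" "card P = p\<^sup>2" "finite P" if "P \<in> \<C>" for P
    using that finite_carrier finite_subset[of P] subgroup.subset[of P G]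
    by (auto simp: \<C>_def elementary_abelian_subgroup_def)
  have commC: "x \<otimes> y = y \<otimes> x" if "P \<in> \<C>" "x \<in> P" "y \<in> P" for P x y
  proof -
    have "comm_group (G\<lparr>carrier := P\<rparr>)"
      using that by (auto simp: \<C>_def elementary_abelian_subgroup_def)
    from comm_group.axioms(1)[OF this] show ?thesis
      using comm_monoid.m_comm[of "G\<lparr>carrier := P\<rparr>" x y] that by simp
  qed
  have span: "power_span a b \<in> \<C>" "a \<in> power_span a b" "b \<in> power_span a b"
    if "a \<in> carrier G" "b \<in> carrier G" "a \<otimes> b = b \<otimes> a" "a \<noteq> \<one>"
      "b \<notin> range (\<lambda>k::int. a [^] k)" for a b
    using that elementary_abelian_power_span card_power_span power_span_incl
    by (simp_all add: \<C>_def)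
  have outside: "\<exists>b \<in> centralizer G a. b \<notin> H"
    if a: "a \<in> carrier G" and H: "H \<subseteq> P" "P \<in> \<C>" for a H P
  proof (rule ccontr)
    assume "\<not> ?thesis"
    then have "centralizer G a \<subseteq> P"
      using H by auto
    then have "card (centralizer G a) \<le> p\<^sup>2"
      using card_mono[OF subC(3)] subC(2) H by metis
    moreover have "p\<^sup>2 < p ^ 3"
      using p1 by simp
    ultimately show False
      using cent[OF a] by simp
  qed
  have zc: "z \<in> carrier G" "\<And>x. x \<in> carrier G \<Longrightarrow> z \<otimes> x = x \<otimes> z"
    using z by (auto simp: group_center_def)
  \<comment> \<open>From the centralizer of \<open>a\<close>, first \<open>b\<close> is chosen
    outside the powers of \<open>a\<close>, then \<open>c\<close> outside the span of
    \<open>a\<close> and \<open>b\<close>. Both choices exist because the sets to be avoided have at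
    most \<open>p\<close> and \<open>p\<^sup>2\<close> elements.\<close>
  have pair: "\<exists>P \<in> \<C>. \<exists>Q \<in> \<C>. P \<inter> Q = range (\<lambda>k::int. a [^] k)"
    if a: "a \<in> carrier G" "a \<noteq> \<one>" for a
  proof -
    let ?A = "range (\<lambda>k::int. a [^] k)"
    have A1: "a \<in> ?A"
      using a by (auto intro: range_eqI[of _ _ 1])
    have "\<exists>b \<in> centralizer G a. b \<notin> ?A"
    proof (rule ccontr)
      assume H: "\<not> ?thesis"
      have "a [^] k \<in> (\<lambda>k. a [^] k) ` {0..<int p}" for k :: int
        using int_pow_cong[OF a(1), of k "k mod int p"] p1
        by (intro image_eqI[of _ _ "k mod int p"]) auto
      then have "card (centralizer G a) \<le> card ((\<lambda>k. a [^] k) ` {0..<int p})"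
        using H by (intro card_mono) auto
      also have "\<dots> \<le> p"
        using card_image_le[of "{0..<int p}" "\<lambda>k. a [^] k"] by simp
      also have "p < p ^ 3"
        using p1 power_strict_increasing[of 1 3 p] by simp
      finally show False
        using cent[OF a(1)] by simp
    qed
    then obtain b where b: "b \<in> carrier G" "a \<otimes> b = b \<otimes> a" "b \<notin> ?A"
      by (auto simp: centralizer_def)
    let ?P = "power_span a b"
    note P = span[OF a(1) b(1,2) a(2) b(3)]
    obtain c where c: "c \<in> carrier G" "a \<otimes> c = c \<otimes> a" "c \<notin> ?P"
      using outside[OF a(1) subset_refl P(1)] by (auto simp: centralizer_def)
    have AP: "?A \<subseteq> ?P"
      using subgroup_int_pow_closed[OF subC(1)[OF P(1)] P(2)] by auto
    then have cA: "c \<notin> ?A"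
      using c by blast
    let ?Q = "power_span a c"
    note Q = span[OF a(1) c(1,2) a(2) cA]
    have AQ: "?A \<subseteq> ?Q"
      using subgroup_int_pow_closed[OF subC(1)[OF Q(1)] Q(2)] by auto
    \<comment> \<open>The choice of \<open>c\<close> makes \<open>?P \<inter> ?Q\<close> proper in
      \<open>?Q\<close>. If it also exceeded \<open>?A\<close>, the chain of three subgroups would
      make \<open>?A\<close> trivial.\<close>
    have "?A = ?P \<inter> ?Q"
    proof (rule ccontr)
      assume "?A \<noteq> ?P \<inter> ?Q"
      then have "?A \<subset> ?P \<inter> ?Q" "?P \<inter> ?Q \<subset> ?Q"
        using AP AQ Q(3) c(3) by auto
      then have "?A = {\<one>}"
        using subgroup_chain_prime_square[OF prime_p finite_carrier subgroup_range_int_pow[OF a(1)]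
            subgroups_Inter_pair[OF subC(1)[OF P(1)] subC(1)[OF Q(1)]] subC(1,2)[OF Q(1)]] by blast
      then show False
        using A1 a(2) by auto
    qed
    then show ?thesis
      using P(1) Q(1) by metis
  qed
  have cov: "group_cover G \<C>"
    unfolding group_cover_def
  proof
    show "\<Union>\<C> = carrier G"
    proof
      show "\<Union>\<C> \<subseteq> carrier G"
        using subC(1) subgroup.subset by blast
      show "carrier G \<subseteq> \<Union>\<C>"
      proof
        fix x assume x: "x \<in> carrier G"
        show "x \<in> \<Union>\<C>"
        proof (cases "x = \<one>")
          \<comment> \<open>The identity lies in every member; \<open>pair\<close> applied to
            \<open>z\<close> shows that a member exists.\<close>
          case True
          then show ?thesis
            using pair[OF zc(1) z(2)] subgroup.one_closed[OF subC(1)] by blast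
        next
          case False
          have "x \<in> range (\<lambda>k::int. x [^] k)"
            using x by (auto intro: range_eqI[of _ _ 1])
          then show ?thesis
            using pair[OF x False] by blast
        qed
      qed
    qed
  qed (use subC(1) in auto)
  then have star: "star_covering p G \<C>"
    by (auto simp: star_covering_def \<C>_def)
  \<comment> \<open>Finite sets of equal size cannot be properly nested.\<close>
  have irr: "irredundant \<C>"
    unfolding irredundant_def using psubset_card_mono subC(2,3) by (metis less_irrefl)
  let ?R = "cover_ring G \<C>"
  have ringR: "ring ?R"
    using ring_cover_ring_star_covering[OF group_axioms star] .
  define h where "h = (\<lambda>k::int. \<lambda>x \<in> carrier G. x [^] k)"
  have hR: "h k \<in> carrier ?R" for k
  proof -
    have "x [^] k \<in> P \<and> (x \<otimes> y) [^] k = x [^] k \<otimes> y [^] k" "x \<in> carrier G" "x \<otimes> y \<in> carrier G"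
      if "P \<in> \<C>" "x \<in> P" "y \<in> P" for P x y
      using that subC(1)[of P] commC[of P x y] subgroup_int_pow_closed[of P x k]
        subgroup.mem_carrier[of P G] int_pow_mult_distrib[of x y k] by auto
    then show ?thesis
      unfolding mem_cover_ring_iff[OF cov] by (auto simp: h_def)
  qed
  have surj: "f \<in> range h" if f: "f \<in> carrier ?R" for f
  proof -
    have fP: "f x \<in> P" "f (x \<otimes> y) = f x \<otimes> f y" if "P \<in> \<C>" "x \<in> P" "y \<in> P" for P x y
      using f that unfolding mem_cover_ring_iff[OF cov] by auto
    have fpow: "f (x [^] k) = f x [^] k" if "x \<in> carrier G" for x and k :: int
    proof -
      obtain P where P: "P \<in> \<C>" "x \<in> P"
        using group_coverE[OF cov \<open>x \<in> carrier G\<close>] .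
      have "f \<in> hom (G\<lparr>carrier := P\<rparr>) (G\<lparr>carrier := P\<rparr>)"
        using fP[OF P(1)] by (auto simp: hom_def)
      then show ?thesis
        using hom_int_pow_subgroup[OF subC(1)[OF P(1)]] P(2) by blast
    qed
    \<comment> \<open>As \<open>f\<close> preserves both members given by \<open>pair\<close>, it
      maps \<open>x\<close> into their intersection, the powers of \<open>x\<close>.\<close>
    have eig: "\<exists>k::int. f x = x [^] k" if x: "x \<in> carrier G" "x \<noteq> \<one>" for x
    proof -
      obtain P Q where PQ: "P \<in> \<C>" "Q \<in> \<C>" "P \<inter> Q = range (\<lambda>k::int. x [^] k)"
        using pair[OF x] by blast
      have "x \<in> range (\<lambda>k::int. x [^] k)"
        using x by (auto intro: range_eqI[of _ _ 1])
      then have "f x \<in> P \<inter> Q"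
        using PQ fP(1)[of _ x x] by blast
      then show ?thesis
        using PQ by auto
    qed
    obtain k :: int where k: "f z = z [^] k"
      using eig[OF zc(1) z(2)] by blast
    have "f x = x [^] k" if x: "x \<in> carrier G" for x
    proof (cases "x \<in> range (\<lambda>i::int. z [^] i)")
      case True
      then obtain i :: int where "x = z [^] i"
        by blast
      then show ?thesis
        using fpow[OF zc(1), of i] k zc(1) by (simp add: int_pow_pow mult.commute)
    next
      case False
      note P = span[OF zc(1) x zc(2)[OF x] z(2) False]
      have x1: "x \<noteq> \<one>"
        using False by (metis int_pow_0 rangeI)
      have zx1: "z \<otimes> x \<noteq> \<one>"
      proof
        assume "z \<otimes> x = \<one>"
        then have "x = z [^] (-1 :: int)"
          using x zc(1) by (metis int_pow_1 int_pow_neg inv_equality inv_inv)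
        then show False
          using False by blast
      qed
      obtain m :: int where m: "f x = x [^] m"
        using eig[OF x x1] by blast
      obtain n :: int where n: "f (z \<otimes> x) = (z \<otimes> x) [^] n"
        using eig[OF _ zx1] x zc(1) by auto
      \<comment> \<open>Both sides are \<open>f (z \<otimes> x)\<close>. Since \<open>x\<close> is
        not a power of \<open>z\<close>, coordinates can be compared: \<open>n\<close> is congruent
        to \<open>k\<close> and to \<open>m\<close> modulo \<open>p\<close>.\<close>
      have "z [^] n \<otimes> x [^] n = z [^] k \<otimes> x [^] m"
        using n m k fP(2)[OF P] int_pow_mult_distrib[OF zc(2)[OF x] zc(1) x] by simp
      then have "int p dvd n - k" "int p dvd n - m"
        by (rule power_span_eq_dest[OF zc(1) x zc(2)[OF x] z(2) False])+
      then have "int p dvd m - k"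
        using dvd_diff[of "int p" "n - k" "n - m"] by simp
      then show ?thesis
        using m int_pow_cong[OF x] by metis
    qed
    moreover have "f \<in> extensional (carrier G)"
      using f unfolding mem_cover_ring_iff[OF cov] by blast
    ultimately have "f = h k"
      by (intro extensionalityI[of _ "carrier G"]) (auto simp: h_def)
    then show ?thesis
      by blast
  qed
  have "h \<in> ring_hom \<Z> ?R"
    by (rule ring_hom_memI)
      (use hR in \<open>auto simp: h_def cover_ring_def compose_def int_pow_mult int_pow_pow mult.commute
        intro!: restrict_ext\<close>)
  then interpret h: ring_hom_ring \<Z> ?R h
    by (intro ring_hom_ringI2 ringR int.ring_axioms)
  have ker: "a_kernel \<Z> ?R h = Idl\<^bsub>\<Z>\<^esub> {int p}"
  proof -
    \<comment> \<open>Evaluation at \<open>z\<close>, which has order \<open>p\<close>, detects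
      whether \<open>p\<close> divides \<open>k\<close>.\<close>
    have "h k = \<zero>\<^bsub>?R\<^esub> \<longleftrightarrow> int p dvd k" for k
    proof
      assume "h k = \<zero>\<^bsub>?R\<^esub>"
      then have "h k z = \<one>"
        using zc(1) by (simp add: cover_ring_def)
      then show "int p dvd k"
        using int_pow_eq_one_iff[OF zc(1) z(2)] zc(1) by (simp add: h_def)
    next
      assume "int p dvd k"
      then show "h k = \<zero>\<^bsub>?R\<^esub>"
        using int_pow_cong[of _ k 0] by (auto simp: h_def cover_ring_def intro!: restrict_ext)
    qed
    then have "a_kernel \<Z> ?R h = {k. int p dvd k}"
      unfolding a_kernel_def' by simp
    also have "\<dots> = {k * int p | k. True}"
      by (auto simp: dvd_def mult.commute[of "int p"])
    finally show ?thesis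
      unfolding int_Idl .
  qed
  have "h ` carrier \<Z> = carrier ?R"
    using hR surj by auto
  then have "ZFact (int p) \<simeq> ?R"
    using h.FactRing_iso by (simp add: ZFact_def ker)
  then have "?R \<simeq> ZFact (int p)"
    by (rule ring_iso_sym[rotated]) (rule cring.axioms(1)[OF ZFact_is_cring])
  then show ?thesis
    using star irr by blast
qed

section \<open>Failure of simplicity when some centralizer is small\<close>

text \<open>Each case feeds an invariant set and a nonzero function trivial on it to
  \<open>not_simple_cover_ring\<close>. Irredundancy enters through \<open>antichain\<close>, the
  order of the centralizer through \<open>chain\<close>.\<close>

lemma not_simple_if_small_centralizer:
  assumes ord: "order G \<ge> p ^ 3"
    and a: "a \<in> carrier G" "card (centralizer G a) = p\<^sup>2"
    and center: "group_center G \<noteq> {\<one>}"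
    and star: "star_covering p G \<C>" and irr: "irredundant \<C>"
  shows "\<not> simple_ring (cover_ring G \<C>)"
proof -
  let ?R = "cover_ring G \<C>"
  define A where "A = centralizer G a"
  define Z where "Z = group_center G"
  have p1: "p > 1"
    using prime_p by (rule prime_gt_1_nat)
  have cov: "group_cover G \<C>"
    using star by (simp add: star_covering_def)
  have ringR: "ring ?R"
    using ring_cover_ring_star_covering[OF group_axioms star] .
  have subA: "subgroup A G" and cardA: "card A = p\<^sup>2"
    using a by (auto simp: A_def subgroup_centralizer)
  have AG: "A \<subset> carrier G"
    using subgroup.subset[OF subA] cardA ord p1 power_strict_increasing[of 2 3 p]
    by (auto simp: order_def)
  have subZ: "subgroup Z G"
    by (simp add: Z_def subgroup_group_center)
  have subC: "subgroup C G" if "C \<in> \<C>" for C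
    using cov that by (simp add: group_cover_def)
  have ex: "\<exists>C \<in> \<C>. x \<in> C" if "x \<in> carrier G" for x
    using group_coverE[OF cov that] by blast
  have antichain: "\<not> C \<subset> D" if "C \<in> \<C>" "D \<in> \<C>" for C D
    using irr that by (simp add: irredundant_def)
  have fC: "f x \<in> C" if "f \<in> carrier ?R" "C \<in> \<C>" "x \<in> C" for f x C
    using that unfolding mem_cover_ring_iff[OF cov] by blast
  have C_cent: "C \<subseteq> centralizer G x" if "C \<in> \<C>" "x \<in> C" for C x
    using comm_group.axioms(1)[OF star_covering_abelian[OF group_axioms star that(1)]]
      comm_monoid.m_comm[of "G\<lparr>carrier := C\<rparr>" _ x] that subgroup.mem_carrier[OF subC]
    by (auto simp: centralizer_def)
  have chain: "H = {\<one>}" if "subgroup H G" "subgroup K G" "H \<subset> K" "K \<subset> A" for H K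
    using subgroup_chain_prime_square[OF prime_p finite_carrier that(1,2) subA cardA that(3,4)] .
  have aA: "a \<in> A"
    using a by (auto simp: A_def centralizer_def)
  have aZ: "a \<notin> Z"
    using AG by (auto simp: A_def Z_def centralizer_def group_center_def)
  have ZA: "Z \<subset> A"
    using aA aZ a by (auto simp: A_def Z_def centralizer_def group_center_def)
  have inter: "subgroup (H \<inter> K) G" if "subgroup H G" "subgroup K G" for H K
    using that by (rule subgroups_Inter_pair)
  \<comment> \<open>If \<open>y\<close> commutes with \<open>x\<close>, then
    \<open>centralizer G y \<inter> A\<close> contains \<open>Z\<close> and also \<open>x\<close>.
    As \<open>Z\<close> is nontrivial, \<open>chain\<close> forces this intersection to be all of
    \<open>A\<close>, so \<open>y\<close> commutes with \<open>a\<close>.\<close>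
  have cent_eq: "centralizer G x \<subseteq> A" if x: "x \<in> A" "x \<notin> Z" for x
  proof
    fix y assume y: "y \<in> centralizer G x"
    have yG: "y \<in> carrier G" and xy: "x \<in> centralizer G y"
      using y subgroup.mem_carrier[OF subA x(1)] by (auto simp: centralizer_def)
    have "Z \<subseteq> centralizer G y"
      using yG by (auto simp: Z_def group_center_def centralizer_def)
    then have "Z \<subset> centralizer G y \<inter> A"
      using x xy ZA by auto
    then have "centralizer G y \<inter> A = A"
      using chain[OF subZ inter[OF subgroup_centralizer[OF yG] subA]] center Z_def by blast
    then have "a \<in> centralizer G y"
      using aA by blast
    then show "y \<in> A"
      using yG by (simp add: A_def centralizer_def)
  qed
  \<comment> \<open>The witness \<open>f\<close> is trivial on \<open>M\<close> and the identity
    elsewhere. It is the identity on each other member, since such a member meets \<open>M\<close>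
    at most in the neutral element.\<close>
  have isolated: ?thesis
    if M: "M \<in> \<C>" "m \<in> M" "m \<noteq> \<one>" "M \<subseteq> A"
      and disj: "\<And>D. D \<in> \<C> \<Longrightarrow> D \<noteq> M \<Longrightarrow> D \<inter> M \<subseteq> {\<one>}" for M m
  proof -
    obtain y where y: "y \<in> carrier G" "y \<notin> M"
      using M(4) AG by blast
    define f where "f = (\<lambda>x \<in> carrier G. if x \<in> M then \<one> else x)"
    have eq: "f x = (if D = M then \<one> else x)" if "D \<in> \<C>" "x \<in> D" for D x
      using that disj[of D] subgroup.mem_carrier[OF subC, of D x] by (auto simp: f_def)
    have "f \<in> carrier ?R"
      unfolding mem_cover_ring_iff[OF cov]
      using subgroup.one_closed[OF subC] subgroup.m_closed[OF subC]
      by (auto simp: eq) (auto simp: f_def)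
    moreover have "f x = \<one>" if "x \<in> M" for x
      using eq[OF M(1) that] by simp
    moreover have "f y \<noteq> \<one>"
      using y subgroup.one_closed[OF subC[OF M(1)]] by (auto simp: f_def)
    ultimately show ?thesis
      using not_simple_cover_ring[OF ringR cov subgroup.subset[OF subC[OF M(1)]] _ M(2,3)]
        fC[OF _ M(1)] y(1) by blast
  qed
  obtain M where M: "M \<in> \<C>" "a \<in> M"
    using ex[OF a(1)] by blast
  have MA: "M \<subseteq> A"
    using C_cent[OF M] by (simp add: A_def)
  have a1: "a \<noteq> \<one>"
    using aZ subgroup.one_closed[OF subZ] by blast
  show ?thesis
  proof (cases "A \<in> \<C>")
    case False
    then have MA': "M \<subset> A"
      using M MA by auto
    \<comment> \<open>Being proper in \<open>A\<close>, the group \<open>M\<close> has no nontrivial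
      proper subgroup; \<open>D \<inter> M\<close> is proper in \<open>M\<close>, as otherwise
      \<open>M\<close> would be nested in \<open>D\<close>.\<close>
    have "D \<inter> M \<subseteq> {\<one>}" if D: "D \<in> \<C>" "D \<noteq> M" for D
    proof (rule ccontr)
      assume "\<not> D \<inter> M \<subseteq> {\<one>}"
      then obtain x where x: "x \<in> D" "x \<in> M" "x \<noteq> \<one>"
        by blast
      have "D \<inter> M \<subset> M"
        using antichain[OF M(1) D(1)] D(2) by blast
      then have "D \<inter> M = {\<one>}"
        using chain[OF inter[OF subC[OF D(1)] subC[OF M(1)]] subC[OF M(1)] _ MA'] by blast
      then show False
        using x by blast
    qed
    then show ?thesis
      by (rule isolated[OF M a1 MA])
  next
    case A: True
    \<comment> \<open>A noncentral \<open>x\<close> in the intersection would give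
      \<open>D \<subseteq> A\<close>: the abelian group \<open>D\<close> centralizes
      \<open>x\<close>, and \<open>cent_eq\<close> applies.\<close>
    have DZ: "D \<inter> A \<subseteq> Z" if D: "D \<in> \<C>" "D \<noteq> A" for D
    proof
      fix x assume x: "x \<in> D \<inter> A"
      have "\<not> D \<subseteq> A"
        using antichain[OF D(1) A] D(2) by blast
      then show "x \<in> Z"
        using x C_cent[OF D(1), of x] cent_eq[of x] by blast
    qed
    show ?thesis
    proof (cases "\<exists>D \<in> \<C>. D \<noteq> A \<and> \<not> D \<inter> A \<subseteq> {\<one>}")
      case False
      then show ?thesis
        by (intro isolated[OF A aA a1]) auto
    next
      case True
      then obtain D where D: "D \<in> \<C>" "D \<noteq> A" "\<not> D \<inter> A \<subseteq> {\<one>}"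
        by blast
      have "D \<inter> A = Z"
        using DZ[OF D(1,2)] chain[OF inter[OF subC[OF D(1)] subA] subZ _ ZA] D(3) by blast
      \<comment> \<open>Hence central elements also lie in a member other than \<open>A\<close>.
        With \<open>DZ\<close>, this makes \<open>carrier G - A \<union> Z\<close> the union of all
        members other than \<open>A\<close>, so the ring preserves it.\<close>
      then have ZD: "Z \<subseteq> D"
        by blast
      obtain z where z: "z \<in> Z" "z \<noteq> \<one>"
        using center subgroup.one_closed[OF subZ] by (auto simp: Z_def)
      then have zc: "z \<in> carrier G" "a \<otimes> z = z \<otimes> a"
        using a(1) by (auto simp: Z_def group_center_def)
      have zpow: "z [^] k \<in> Z" for k :: int
        using subgroup_int_pow_closed[OF subZ z(1)] .
      \<comment> \<open>If \<open>z\<close> were a power of \<open>a\<close>, its exponent would be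
        prime to \<open>p\<close>, and \<open>a\<close> would be central with
        \<open>z\<close>.\<close>
      have out: "z \<notin> range (\<lambda>k::int. a [^] k)"
      proof
        assume "z \<in> range (\<lambda>k::int. a [^] k)"
        then obtain k :: int where k: "z = a [^] k"
          by blast
        then have "\<not> int p dvd k"
          using int_pow_eq_one_iff[OF a(1) a1] z(2) by auto
        then show False
          using mem_of_int_pow_mem[OF subZ a(1)] k z(1) aZ by blast
      qed
      have spanA: "power_span a z = A"
      proof (rule card_subset_eq)
        show "finite A"
          using AG finite_carrier finite_subset by blast
        show "power_span a z \<subseteq> A"
          using subgroup_int_pow_closed[OF subA] aA z(1) ZA subgroup.m_closed[OF subA]
          by (auto simp: power_span_def)
        show "card (power_span a z) = card A"
          using card_power_span[OF a(1) zc a1 out] cardA by simp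
      qed
      \<comment> \<open>The exponent of \<open>a\<close> in \<open>x\<close> is determined only
        modulo \<open>p\<close>, which suffices because it is used only as an exponent of
        \<open>z\<close>.\<close>
      define e where "e x = (SOME i::int. \<exists>j::int. x = a [^] i \<otimes> z [^] j)" for x
      define f where "f = (\<lambda>x \<in> carrier G. if x \<in> A then z [^] e x else \<one>)"
      have f_eq: "f (a [^] i \<otimes> z [^] j) = z [^] i" for i j :: int
      proof -
        let ?x = "a [^] i \<otimes> z [^] j"
        have "\<exists>l::int. ?x = a [^] e ?x \<otimes> z [^] l"
          unfolding e_def by (rule someI_ex) blast
        then have "int p dvd i - e ?x"
          using power_span_eq_dest(1)[OF a(1) zc a1 out] by blast
        then have "z [^] i = z [^] e ?x"
          by (rule int_pow_cong[OF zc(1)])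
        moreover have "?x \<in> A"
          unfolding spanA[symmetric] power_span_def by blast
        ultimately show ?thesis
          using AG by (auto simp: f_def)
      qed
      \<comment> \<open>In a central element \<open>a [^] i \<otimes> z [^] j\<close> the factor
        \<open>a [^] i\<close> is central; as \<open>a\<close> is not, \<open>p\<close> divides
        \<open>i\<close>.\<close>
      have fZ: "f x = \<one>" if "x \<in> Z" for x
      proof -
        have "x \<in> power_span a z"
          using that ZA spanA by blast
        then obtain i j :: int where x: "x = a [^] i \<otimes> z [^] j"
          by (auto simp: power_span_def)
        have "a [^] i = x \<otimes> inv (z [^] j)"
          using x a(1) zc(1) by (simp add: inv_solve_right)
        then have "a [^] i \<in> Z"
          using that zpow subgroup.m_closed[OF subZ] subgroup.m_inv_closed[OF subZ] by simp
        then have "int p dvd i"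
          using mem_of_int_pow_mem[OF subZ a(1)] aZ by blast
        then show ?thesis
          using x f_eq int_pow_eq_one_iff[OF zc(1) z(2)] by simp
      qed
      have fR: "f \<in> carrier ?R"
        unfolding mem_cover_ring_iff[OF cov]
      proof (intro conjI ballI)
        show "f \<in> extensional (carrier G)"
          by (simp add: f_def)
      next
        fix C x assume C: "C \<in> \<C>" "x \<in> C"
        \<comment> \<open>Outside \<open>A\<close> this is the default value of \<open>f\<close>;
          inside \<open>A\<close>, \<open>DZ\<close> places \<open>w\<close> in
          \<open>Z\<close>.\<close>
        have triv: "f w = \<one>" if "w \<in> C" "C \<noteq> A" for w
          using that DZ[OF C(1)] fZ[of w] subgroup.mem_carrier[OF subC[OF C(1)]]
          by (auto simp: f_def)
        show "f x \<in> C"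
          using triv[OF C(2)] subgroup.one_closed[OF subC[OF C(1)]] zpow ZA C
            subgroup.mem_carrier[OF subA]
          by (cases "C = A") (auto simp: f_def)
        fix y assume y: "y \<in> C"
        show "f (x \<otimes> y) = f x \<otimes> f y"
        proof (cases "C = A")
          case True
          then have "x \<in> power_span a z" "y \<in> power_span a z"
            using C(2) y spanA by auto
          then obtain i j k l :: int where
            "x = a [^] i \<otimes> z [^] j" "y = a [^] k \<otimes> z [^] l"
            by (auto simp: power_span_def)
          then have "f (x \<otimes> y) = z [^] (i + k)" "f x = z [^] i" "f y = z [^] k"
            by (simp_all only: power_span_mult[OF a(1) zc] f_eq)
          then show ?thesis
            using zc(1) by (simp add: int_pow_mult)
        next
          case False
          then show ?thesis
            using triv C(2) y subgroup.m_closed[OF subC[OF C(1)]] by simp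
        qed
      qed
      have fa: "f a \<noteq> \<one>"
        using f_eq[of 1 0] a(1) zc(1) z(2) by simp
      have "f x = \<one>" if "x \<in> carrier G - A \<union> Z" for x
        using that by (cases "x \<in> Z") (simp add: fZ, simp add: f_def)
      moreover have "g x \<in> carrier G - A \<union> Z"
        if g: "g \<in> carrier ?R" and x: "x \<in> carrier G - A \<union> Z" for g x
      proof -
        obtain C where C: "C \<in> \<C>" "C \<noteq> A" "x \<in> C"
          using x ex[of x] D ZD by blast
        then show ?thesis
          using fC[OF g C(1,3)] DZ[OF C(1,2)] subgroup.mem_carrier[OF subC[OF C(1)]] by blast
      qed
      ultimately show ?thesis
        using not_simple_cover_ring[OF ringR cov, of "carrier G - A \<union> Z" z f a] z fR fa a(1)
          subgroup.subset[OF subZ] by blast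
    qed
  qed
qed

end

theorem theorem3p12:
  fixes G :: "('a, 'b) monoid_scheme" and p :: nat
  assumes "Factorial_Ring.prime p"
    and "finite_p_group p G"
    and "group_exponent G = p"
  shows "((\<forall>a \<in> carrier G. card (centralizer G a) \<ge> p ^ 3) \<longrightarrow>
            (\<exists>\<C>. star_covering p G \<C> \<and> irredundant \<C> \<and> cover_ring G \<C> \<simeq> ZFact (int p)))
       \<and> (order G \<ge> p ^ 3 \<and> (\<exists>a \<in> carrier G. card (centralizer G a) = p ^ 2) \<longrightarrow>
            (\<forall>\<C>. star_covering p G \<C> \<and> irredundant \<C> \<longrightarrow> \<not> simple_ring (cover_ring G \<C>)))"
proof -
  interpret group G
    using assms(2) by (simp add: finite_p_group_def)
  obtain n where fin: "finite (carrier G)" and n: "order G = p ^ n"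
    using assms(2) by (auto simp: finite_p_group_def)
  \<comment> \<open>The group order witnesses that the \<open>LEAST\<close> in
    \<open>group_exponent\<close> is attained.\<close>
  have "0 < order G \<and> (\<forall>x \<in> carrier G. x [^]\<^bsub>G\<^esub> order G = \<one>\<^bsub>G\<^esub>)"
    using fin pow_order_eq_1 order_gt_0_iff_finite by blast
  then have "0 < group_exponent G \<and> (\<forall>x \<in> carrier G. x [^]\<^bsub>G\<^esub> group_exponent G = \<one>\<^bsub>G\<^esub>)"
    unfolding group_exponent_def by (rule LeastI)
  then interpret prime_exponent_group G p
    using assms(1,3) fin by unfold_locales auto
  have "carrier G \<noteq> {\<one>\<^bsub>G\<^esub>}"
  proof
    assume "carrier G = {\<one>\<^bsub>G\<^esub>}"
    then have "group_exponent G \<le> 1"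
      unfolding group_exponent_def by (intro Least_le) simp
    then show False
      using assms(3) prime_gt_1_nat[OF assms(1)] by simp
  qed
  then have center: "group_center G \<noteq> {\<one>\<^bsub>G\<^esub>}"
    using p_group_center_nontrivial[OF assms(1) fin n] by blast
  then obtain z where z: "z \<in> group_center G" "z \<noteq> \<one>\<^bsub>G\<^esub>"
    using subgroup.one_closed[OF subgroup_group_center] by blast
  show ?thesis
  proof (intro conjI impI allI)
    assume "\<forall>a \<in> carrier G. card (centralizer G a) \<ge> p ^ 3"
    then show "\<exists>\<C>. star_covering p G \<C> \<and> irredundant \<C> \<and> cover_ring G \<C> \<simeq> ZFact (int p)"
      by (intro exI) (rule cover_ring_iso_ZFact[OF _ z], simp)
  next
    fix \<C> assume "order G \<ge> p ^ 3 \<and> (\<exists>a \<in> carrier G. card (centralizer G a) = p ^ 2)"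
      and "star_covering p G \<C> \<and> irredundant \<C>"
    then show "\<not> simple_ring (cover_ring G \<C>)"
      using center by (elim conjE bexE) (rule not_simple_if_small_centralizer)
  qed
qed

end
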